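(* Let $\tau,\beta>0$ and let $A\in M_N(\mathbb{R}_{\ge0})$ be any nonnegative $N\times N$ connectivity matrix with a directed spanning tree. Consider the system $$\frac{d}{dt}z_j=\sum_{l=1}^N A_{jl}(z_l-z_j)+\frac1\tau\Bigl(1-\frac{|z_j|^2}{\beta^2}\Bigr)z_j,\qquad z_j\in\mathbb{C},\ j\in\{1,\dots,N\}.$$ Then the fixed point $z_j=0$ for all $j\in\{1,\dots,N\}$ is linearly unstable, while the class of fixed points such that $z_j=z_k$ for all $j,k\in\{1,\dots,N\}$ with $|z_j|=\beta$ is linearly stable.
   Context: The matrix $A$ characterizes a directed weighted graph with vertex set $\{1,\dots,N\}$, in which $(i,j)$ is a directed edge if and only if $A_{ij}>0$, with weight $A_{ij}$. A path of length $q\le N$ is a sequence of $q$ nodes $(j_s)_{s\in\{1,\dots,q\}}$ satisfying $A_{j_s,j_{s+1}}>0$ for all $s\in\{1,\dots,q-1\}$; it is a path from $j_1$ to $j_q$. The matrix $A$ has a directed spanning tree if its graph does, i.e. if there exists a node $j_0\in\{1,\dots,N\}$ (the root) such that for every $k\in\{1,\dots,N\}\setminus\{j_0\}$ there exists a path from $j_0$ to $k$. View the system as an ODE in $\mathbb{C}^N\cong\mathbb{R}^{2N}$. A fixed point is linearly unstable if the $2N\times2N$ Jacobian there has an eigenvalue with strictly positive real part. The class of synchronized fixed points $z_1=\dots=z_N=\beta e^{i\theta}$, $\theta\in\mathbb{R}/2\pi\mathbb{Z}$, is linearly stable if at each such point the Jacobian has $0$ as a simple eigenvalue (due to invariance under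 global rotation) and the other $2N-1$ eigenvalues have strictly negative real part.
   Formalization: The directed spanning tree is required of the transpose of A instead of A; as stated the claim fails, e.g. N=3, A_12=A_13=1, other entries 0: node 1 is a root, but 0 is a double eigenvalue at every synchronized fixed point. *)

theory Defs
  imports "HOL-Analysis.Analysis" "HOL-Computational_Algebra.Polynomial"
begin

section \<open>Directed graph of a nonnegative matrix\<close>

definition graph_path :: "real^'n^'n \<Rightarrow> 'n list \<Rightarrow> bool" where
  "graph_path A js \<longleftrightarrow> js \<noteq> [] \<and> length js \<le> CARD('n) \<and>
     (\<forall>s. Suc s < length js \<longrightarrow> A $ (js ! s) $ (js ! Suc s) > 0)"

definition path_from_to :: "real^'n^'n \<Rightarrow> 'n \<Rightarrow> 'n \<Rightarrow> bool" where
  "path_from_to A j k \<longleftrightarrow> (\<exists>js. graph_path A js \<and> hd js = j \<and> last js = k)"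

text \<open>
  The pair \<open>(i, j)\<close> is an edge iff \<open>A $ i $ j > 0\<close>, and the root reaches every other node.
  In the system below, \<open>A $ j $ l > 0\<close> means that node \<open>l\<close> influences node \<open>j\<close>, so influence
  travels along the edges of the graph of \<open>transpose A\<close>.  The stability claim needs a root whose
  influence reaches all nodes, that is, a spanning tree of \<open>transpose A\<close>; a spanning tree of
  \<open>A\<close> itself does not suffice.  For three nodes whose only edges in the graph of \<open>A\<close> are
  \<open>(1, 2)\<close> and \<open>(1, 3)\<close>, node 1 is a root, but nodes 2 and 3 evolve independently of all
  others, so 0 is a double eigenvalue of the Jacobian at every synchronized fixed point.
\<close>

definition has_directed_spanning_tree :: "real^'n^'n \<Rightarrow> bool" where
  "has_directed_spanning_tree A \<longleftrightarrow> (\<exists>j0. \<forall>k. k \<noteq> j0 \<longrightarrow> path_from_to A j0 k)"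


section \<open>Linear stability of vector fields on complex space\<close>

text \<open>
  The identification of \<open>complex^'n\<close> with a real space of twice the dimension: the \<open>Inl\<close>
  coordinates are the real parts, the \<open>Inr\<close> coordinates the imaginary parts.
\<close>

definition real_coords :: "complex^'n \<Rightarrow> real^('n + 'n)" where
  "real_coords z = (\<chi> i. case i of Inl j \<Rightarrow> Re (z $ j) | Inr j \<Rightarrow> Im (z $ j))"

definition complex_coords :: "real^('n + 'n) \<Rightarrow> complex^'n" where
  "complex_coords x = (\<chi> j. Complex (x $ Inl j) (x $ Inr j))"

definition real_jacobian :: "(complex^'n \<Rightarrow> complex^'n) \<Rightarrow> complex^'n \<Rightarrow> real^('n + 'n)^('n + 'n)" where
  "real_jacobian F z = jacobian (real_coords \<circ> F \<circ> complex_coords) (at (real_coords z))"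

text \<open>Eigenvalues of a real matrix are taken over the complex numbers.\<close>

definition complexify :: "real^'m^'m \<Rightarrow> complex^'m^'m" where
  "complexify M = (\<chi> i j. complex_of_real (M $ i $ j))"

definition eigenvalue :: "real^'m^'m \<Rightarrow> complex \<Rightarrow> bool" where
  "eigenvalue M c \<longleftrightarrow> (\<exists>v. v \<noteq> 0 \<and> complexify M *v v = c *s v)"

definition characteristic_poly :: "real^'m^'m \<Rightarrow> complex poly" where
  "characteristic_poly M = det (\<chi> i j. (if i = j then [:0, 1:] else 0) - [:complexify M $ i $ j:])"

definition simple_eigenvalue :: "real^'m^'m \<Rightarrow> complex \<Rightarrow> bool" where
  "simple_eigenvalue M c \<longleftrightarrow> eigenvalue M c \<and> order c (characteristic_poly M) = 1"

definition fixed_point :: "(complex^'n \<Rightarrow> complex^'n) \<Rightarrow> complex^'n \<Rightarrow> bool" where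
  "fixed_point F z \<longleftrightarrow> F z = 0"

definition linearly_unstable :: "(complex^'n \<Rightarrow> complex^'n) \<Rightarrow> complex^'n \<Rightarrow> bool" where
  "linearly_unstable F z \<longleftrightarrow> fixed_point F z \<and> (\<exists>c. eigenvalue (real_jacobian F z) c \<and> Re c > 0)"

text \<open>
  Since 0 has algebraic multiplicity one, the remaining \<open>2 * CARD('n) - 1\<close> eigenvalues, counted
  with multiplicity, are exactly the nonzero ones.
\<close>

definition linearly_stable_class :: "(complex^'n \<Rightarrow> complex^'n) \<Rightarrow> (complex^'n) set \<Rightarrow> bool" where
  "linearly_stable_class F S \<longleftrightarrow>
     (\<forall>z\<in>S. fixed_point F z \<and> simple_eigenvalue (real_jacobian F z) 0 \<and>
       (\<forall>c. eigenvalue (real_jacobian F z) c \<and> c \<noteq> 0 \<longrightarrow> Re c < 0))"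


section \<open>The coupled system\<close>

definition coupled_field :: "real \<Rightarrow> real \<Rightarrow> real^'n^'n \<Rightarrow> complex^'n \<Rightarrow> complex^'n" where
  "coupled_field \<tau> \<beta> A z =
     (\<chi> j. (\<Sum>l\<in>UNIV. complex_of_real (A $ j $ l) * (z $ l - z $ j))
          + complex_of_real (1 / \<tau> * (1 - (cmod (z $ j))\<^sup>2 / \<beta>\<^sup>2)) * z $ j)"

definition synchronized_class :: "real \<Rightarrow> (complex^'n) set" where
  "synchronized_class \<beta> = {z. (\<forall>j k. z $ j = z $ k) \<and> (\<forall>j. cmod (z $ j) = \<beta>)}"

end

theory Submission
  imports Defs
begin

text \<open>
  At the fixed points in question, the differential of the field splits into two shifted copies of
  the weighted graph Laplacian \<open>L v = (\<Sum>l. A\<^bsub>jl\<^esub> (v\<^bsub>l\<^esub> - v\<^bsub>j\<^esub>))\<^bsub>j\<^esub>\<close>.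

  At the origin it acts as \<open>L + 1/\<tau>\<close> on real and on imaginary parts. Constant vectors lie in the
  kernel of \<open>L\<close>, so \<open>1/\<tau> > 0\<close> is an eigenvalue and the origin is unstable.

  At a synchronized point with common value \<open>w\<close>, \<open>\<bar>w\<bar> = \<beta>\<close>, the reaction term only damps
  perturbations in the direction of \<open>w\<close>. If every component of a perturbation is decomposed into
  its part along \<open>w\<close> and its part along \<open>i w\<close>, the Jacobian becomes block diagonal, with \<open>L - 2/\<tau>\<close>
  on radial parts and \<open>L\<close> on tangential parts (\<open>jacobian_synchronized\<close>). Since \<open>A\<close> is nonnegative
  and the rows of \<open>L\<close> sum to zero, the Gershgorin discs of \<open>L\<close> lie in the left half-plane and touch
  the imaginary axis only at 0 (\<open>laplacian_eigenvalue\<close>). Thus all eigenvalues of the radial block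
  have negative real part, and so have all nonzero eigenvalues of the tangential block.

  Simplicity of the eigenvalue 0 concerns the tangential block alone. The maximum principle shows
  that a solution of \<open>L q = const\<close> has right-hand side zero, so that 0 has no Jordan chain over the
  constant vectors, and that \<open>q\<close> is constant as soon as some root influences every node: the maximum
  and the minimum both propagate backwards along paths to the root
  (\<open>complex_laplacian_eq_const\<close>). Cramer's rule turns this statement about solutions
  into algebraic multiplicity one (\<open>simple_zero_eigenvalue\<close>).
\<close>

section \<open>Spectrum and kernel of the weighted graph Laplacian\<close>

text \<open>
  The sign is that of diffusion, opposite to the positive semidefinite Laplacian of graph theory.
  One definition serves the real perturbations and the complex eigenvectors.
\<close>

definition laplacian :: "real^'n^'n \<Rightarrow> ('a::real_vector)^'n \<Rightarrow> 'a^'n" where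
  "laplacian A v = (\<chi> j. \<Sum>l\<in>UNIV. (A $ j $ l) *\<^sub>R (v $ l - v $ j))"

lemma laplacian_const [simp]: "laplacian A (\<chi> j. c) = 0"
  by (simp add: laplacian_def vec_eq_iff)

lemma Re_laplacian: "Re (laplacian A v $ j) = laplacian A (\<chi> l. Re (v $ l)) $ j"
  and Im_laplacian: "Im (laplacian A v $ j) = laplacian A (\<chi> l. Im (v $ l)) $ j"
  by (simp_all add: laplacian_def)

lemma laplacian_uminus: "laplacian A (- v) = - laplacian A v"
  by (simp add: laplacian_def vec_eq_iff sum_negf[symmetric] scaleR_diff_right)

lemma laplacian_lincomb:
  fixes a b :: real and x y :: "complex^'n"
  shows "laplacian A (\<chi> j. a * x $ j + b * y $ j) $ j = a * laplacian A x $ j + b * laplacian A y $ j"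
  by (simp add: laplacian_def sum_distrib_left flip: sum.distrib)
    (rule sum.cong, auto simp: scaleR_conv_of_real algebra_simps)

lemma ex_max_value:
  fixes f :: "'n::finite \<Rightarrow> real"
  obtains j where "\<And>l. f l \<le> f j"
proof -
  have "Max (range f) \<in> range f" by (intro Max_in) auto
  then obtain j where "f j = Max (range f)" by (metis rangeE)
  then have "f l \<le> f j" for l by simp
  then show thesis by (rule that)
qed

text \<open>
  Gershgorin's argument. At a coordinate \<open>j\<close> where \<open>\<bar>v\<bar>\<close> is maximal, the eigenvalue equation reads
  \<open>(c + d) v\<^bsub>j\<^esub> = (\<Sum>l. A\<^bsub>jl\<^esub> v\<^bsub>l\<^esub>)\<close> with \<open>d\<close> the \<open>j\<close>-th row sum of \<open>A\<close>, whence \<open>\<bar>c + d\<bar> \<le> d\<close>. This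
  disc is tangent to the imaginary axis at 0.
\<close>

lemma laplacian_eigenvalue:
  fixes A :: "real^'n^'n" and v :: "complex^'n"
  assumes nonneg: "\<And>i j. A $ i $ j \<ge> 0"
    and eig: "\<And>j. laplacian A v $ j = c * v $ j" and "v \<noteq> 0"
  shows "c = 0 \<or> Re c < 0"
proof -
  obtain j where jmax: "\<And>l. cmod (v $ l) \<le> cmod (v $ j)"
    using ex_max_value[of "\<lambda>l. cmod (v $ l)"] by blast
  obtain l where "v $ l \<noteq> 0" using \<open>v \<noteq> 0\<close> by (auto simp: vec_eq_iff)
  then have pos: "cmod (v $ j) > 0" using jmax[of l] by (metis less_le_trans zero_less_norm_iff)
  define d where "d = (\<Sum>l\<in>UNIV. A $ j $ l)"
  have "(c + of_real d) * v $ j = (\<Sum>l\<in>UNIV. A $ j $ l *\<^sub>R v $ l)"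
    using eig[of j]
    by (simp add: laplacian_def d_def algebra_simps sum_subtractf sum_distrib_left scaleR_conv_of_real)
  then have "cmod (c + of_real d) * cmod (v $ j) = cmod (\<Sum>l\<in>UNIV. A $ j $ l *\<^sub>R v $ l)"
    by (metis norm_mult)
  also have "\<dots> \<le> (\<Sum>l\<in>UNIV. A $ j $ l * cmod (v $ j))"
    by (rule order_trans[OF norm_sum sum_mono])
      (auto simp: nonneg intro!: mult_left_mono jmax)
  also have "\<dots> = d * cmod (v $ j)"
    by (simp add: d_def sum_distrib_right)
  finally have le: "cmod (c + of_real d) \<le> d" using pos by simp
  then have "(cmod (c + of_real d))\<^sup>2 \<le> d\<^sup>2"
    by (rule power_mono) simp
  then have disc: "(Re c)\<^sup>2 + (Im c)\<^sup>2 + 2 * d * Re c \<le> 0"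
    by (simp add: cmod_power2 power2_sum algebra_simps)
  have "d \<ge> 0" by (simp add: d_def nonneg sum_nonneg)
  show ?thesis
  proof (cases "Re c < 0")
    case False
    with \<open>d \<ge> 0\<close> have "2 * d * Re c \<ge> 0" by simp
    with disc have "(Re c)\<^sup>2 + (Im c)\<^sup>2 \<le> 0" by linarith
    then show ?thesis by (simp add: complex_eq_iff sum_power2_le_zero_iff)
  qed simp
qed

text \<open>
  The maximum principle: at a maximum all summands of the Laplacian are nonpositive, so if they
  add up to zero, the maximum is also attained at every node that influences this one.
\<close>

lemma laplacian_at_max:
  fixes v :: "real^'n"
  assumes nonneg: "\<And>i j. A $ i $ j \<ge> 0" and jmax: "\<And>l. v $ l \<le> v $ j"
  shows "laplacian A v $ j \<le> 0"
    and "laplacian A v $ j = 0 \<Longrightarrow> A $ j $ l > 0 \<Longrightarrow> v $ l = v $ j"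
proof -
  have nonpos: "A $ j $ l * (v $ l - v $ j) \<le> 0" for l
    using nonneg jmax by (simp add: mult_le_0_iff)
  then show "laplacian A v $ j \<le> 0" by (simp add: laplacian_def sum_nonpos)
  assume "laplacian A v $ j = 0" "A $ j $ l > 0"
  then have "(\<Sum>l\<in>UNIV. - (A $ j $ l * (v $ l - v $ j))) = 0"
    by (simp add: laplacian_def sum_negf)
  with nonpos have "\<forall>l\<in>UNIV. - (A $ j $ l * (v $ l - v $ j)) = 0"
    by (subst (asm) sum_nonneg_eq_0_iff) auto
  with \<open>A $ j $ l > 0\<close> show "v $ l = v $ j" by (auto dest: spec[of _ l])
qed

lemma laplacian_eq_const_nonpos:
  fixes v :: "real^'n"
  assumes nonneg: "\<And>i j. A $ i $ j \<ge> 0" and const: "\<And>j. laplacian A v $ j = s"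
  shows "s \<le> 0"
proof -
  obtain j where "\<And>l. v $ l \<le> v $ j" using ex_max_value[of "($) v"] by blast
  from laplacian_at_max(1)[OF nonneg this] show ?thesis by (simp add: const)
qed

text \<open>
  Evaluating at a maximum gives \<open>s \<le> 0\<close>, and at a minimum \<open>s \<ge> 0\<close>. Hence constant vectors are not in
  the range of the Laplacian unless they vanish.
\<close>

lemma laplacian_eq_const_zero:
  fixes v :: "real^'n"
  assumes nonneg: "\<And>i j. A $ i $ j \<ge> 0" and const: "\<And>j. laplacian A v $ j = s"
  shows "s = 0"
  using laplacian_eq_const_nonpos[of A v s] laplacian_eq_const_nonpos[of A "- v" "- s"] assms
  by (simp add: laplacian_uminus)

text \<open>
  The path runs in the direction of influence, from \<open>j\<close> to \<open>k\<close>. The maximum at its end is carried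
  back to its start one edge at a time.
\<close>

lemma harmonic_max_along_path:
  fixes v :: "real^'n"
  assumes nonneg: "\<And>i j. A $ i $ j \<ge> 0" and harmonic: "laplacian A v = 0"
    and kmax: "\<And>l. v $ l \<le> v $ k" and path: "path_from_to (transpose A) j k"
  shows "v $ j = v $ k"
proof -
  obtain js where "js \<noteq> []" "hd js = j" "last js = k"
    and edge: "\<And>s. Suc s < length js \<Longrightarrow> A $ (js ! Suc s) $ (js ! s) > 0"
    using path by (auto simp: path_from_to_def graph_path_def transpose_def)
  have "v $ (js ! (length js - 1 - i)) = v $ k" if "i < length js" for i
    using that
  proof (induction i)
    case 0
    then show ?case using \<open>js \<noteq> []\<close> \<open>last js = k\<close> by (simp add: last_conv_nth)
  next
    case (Suc i)
    let ?s = "length js - 1 - Suc i"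
    have s: "Suc ?s = length js - 1 - i" and "Suc ?s < length js" using Suc.prems by auto
    have IH: "v $ (js ! Suc ?s) = v $ k" using Suc s by simp
    have "v $ (js ! ?s) = v $ (js ! Suc ?s)"
      by (rule laplacian_at_max(2)[of A]) (use nonneg harmonic kmax IH edge \<open>Suc ?s < length js\<close> in auto)
    with IH show ?case by simp
  qed
  from this[of "length js - 1"] \<open>js \<noteq> []\<close> \<open>hd js = j\<close> show ?thesis by (simp add: hd_conv_nth)
qed

lemma harmonic_le_root:
  fixes v :: "real^'n"
  assumes nonneg: "\<And>i j. A $ i $ j \<ge> 0" and harmonic: "laplacian A v = 0"
    and root: "\<And>k. k \<noteq> j0 \<Longrightarrow> path_from_to (transpose A) j0 k"
  shows "v $ l \<le> v $ j0"
proof -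
  obtain k where kmax: "\<And>l. v $ l \<le> v $ k" using ex_max_value[of "($) v"] by blast
  have "v $ j0 = v $ k"
    using harmonic_max_along_path[OF nonneg harmonic kmax root] by (cases "k = j0") auto
  with kmax show ?thesis by metis
qed

text \<open>
  The root attains both the maximum and, by the same argument for \<open>- v\<close>, the minimum.
\<close>

lemma harmonic_constant:
  fixes v :: "real^'n"
  assumes nonneg: "\<And>i j. A $ i $ j \<ge> 0" and harmonic: "laplacian A v = 0"
    and "has_directed_spanning_tree (transpose A)"
  obtains r where "\<And>l. v $ l = r"
proof -
  obtain j0 where root: "\<And>k. k \<noteq> j0 \<Longrightarrow> path_from_to (transpose A) j0 k"
    using assms(3) by (auto simp: has_directed_spanning_tree_def)
  have "v $ l = v $ j0" for l
    using harmonic_le_root[OF nonneg harmonic root, of l]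
      harmonic_le_root[OF nonneg _ root, of "- v" l] harmonic
    by (simp add: laplacian_uminus)
  then show thesis by (rule that)
qed

lemma complex_laplacian_eq_const:
  fixes v :: "complex^'n"
  assumes nonneg: "\<And>i j. A $ i $ j \<ge> 0"
    and tree: "has_directed_spanning_tree (transpose A)"
    and const: "\<And>j. laplacian A v $ j = s"
  obtains r where "s = 0" "\<And>l. v $ l = r"
proof -
  have re: "laplacian A (\<chi> l. Re (v $ l)) $ j = Re s" for j
    by (simp add: const flip: Re_laplacian)
  have im: "laplacian A (\<chi> l. Im (v $ l)) $ j = Im s" for j
    by (simp add: const flip: Im_laplacian)
  have "Re s = 0" "Im s = 0"
    using laplacian_eq_const_zero[OF nonneg re] laplacian_eq_const_zero[OF nonneg im] by auto
  with re im have "laplacian A (\<chi> l. Re (v $ l)) = 0" "laplacian A (\<chi> l. Im (v $ l)) = 0"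
    by (auto simp: vec_eq_iff)
  then obtain x y where "\<And>l. Re (v $ l) = x" "\<And>l. Im (v $ l) = y"
    using harmonic_constant[OF nonneg _ tree] by (metis vec_lambda_beta)
  then show thesis using that[of "Complex x y"] \<open>Re s = 0\<close> \<open>Im s = 0\<close>
    by (simp add: complex_eq_iff)
qed

section \<open>Algebraically simple zero eigenvalues\<close>

lemma poly_det: "poly (det B) x = det (\<chi> i j. poly (B $ i $ j) x)"
  by (simp add: det_def poly_sum poly_prod poly_mult)

text \<open>
  The third hypothesis says that the kernel is spanned by \<open>v\<close> and that no Jordan chain continues
  \<open>v\<close>. To extract the factor \<open>x\<close> from the characteristic polynomial, pick \<open>k\<close> with \<open>v\<^bsub>k\<^esub> \<noteq> 0\<close>. As
  \<open>(x - M) v = x v\<close>, Cramer's rule gives \<open>v\<^bsub>k\<^esub> det (x - M) = x det Q(x)\<close>, where \<open>Q\<close> is \<open>x - M\<close> with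
  its \<open>k\<close>-th column replaced by \<open>v\<close>. A vector \<open>u\<close> in the kernel of \<open>Q(0)\<close> yields \<open>M u' = u\<^bsub>k\<^esub> v\<close>, where
  \<open>u'\<close> is \<open>u\<close> with its \<open>k\<close>-th entry set to zero; the hypothesis then forces \<open>u = 0\<close>. So \<open>Q(0)\<close> is
  invertible and \<open>x\<close> divides the characteristic polynomial exactly once.
\<close>

lemma simple_zero_eigenvalue:
  fixes M :: "real^'m^'m" and v :: "complex^'m"
  assumes "v \<noteq> 0" and ker: "complexify M *v v = 0"
    and semisimple: "\<And>u c. complexify M *v u = c *s v \<Longrightarrow> c = 0 \<and> (\<exists>d. u = d *s v)"
  shows "simple_eigenvalue M 0"
proof -
  obtain k where "v $ k \<noteq> 0" using \<open>v \<noteq> 0\<close> by (auto simp: vec_eq_iff)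
  define P :: "complex poly^'m^'m" where
    "P = (\<chi> i j. (if i = j then [:0, 1:] else 0) - [:complexify M $ i $ j:])"
  define Q where "Q = (\<chi> i j. if j = k then [:v $ i:] else P $ i $ j)"
  have "v $ k * poly (det P) x = x * poly (det Q) x" for x
  proof -
    define B :: "complex^'m^'m" where
      "B = (\<chi> i j. (if i = j then x else 0) - complexify M $ i $ j)"
    define C where "C = (\<chi> i j. if j = k then v $ i else B $ i $ j)"
    have "B *v v = x *s v"
    proof -
      have "B = mat x - complexify M"
        by (simp add: B_def vec_eq_iff mat_def)
      then have "B *v v = mat x *v v - complexify M *v v"
        by (simp only: matrix_vector_mult_diff_rdistrib)
      moreover have "mat x *v v = x *s v"
        by (simp add: matrix_vector_mult_def mat_def vec_eq_iff if_distrib[of "\<lambda>a. a * _"] cong: if_cong)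
      ultimately show ?thesis using ker by simp
    qed
    have "v $ k * det B = det (\<chi> i j. if j = k then (B *v v) $ i else B $ i $ j)"
      by (rule cramer_lemma[symmetric])
    also have "\<dots> = det (\<chi> i j. if j = k then x * C $ i $ j else C $ i $ j)"
      unfolding \<open>B *v v = x *s v\<close> C_def
      by (rule arg_cong[where f = det]) (simp add: vec_eq_iff)
    also have "\<dots> = x * det C"
    proof -
      \<comment> \<open>Transposition turns the scaled column into a scaled row, to which \<open>det_row_mul\<close> applies.\<close>
      have "det (\<chi> i j. if j = k then x * C $ i $ j else C $ i $ j)
          = det (transpose (\<chi> i j. if j = k then x * C $ i $ j else C $ i $ j))"
        by (simp add: det_transpose)
      also have "transpose (\<chi> i j. if j = k then x * C $ i $ j else C $ i $ j)
          = (\<chi> i. if i = k then x *s transpose C $ i else transpose C $ i)"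
        by (simp add: vec_eq_iff transpose_def)
      also have "det \<dots> = x * det (\<chi> i. if i = k then transpose C $ i else transpose C $ i)"
        by (rule det_row_mul)
      also have "\<dots> = x * det C" by (simp add: det_transpose)
      finally show ?thesis .
    qed
    finally have "v $ k * det B = x * det C" .
    moreover have "poly (det P) x = det B"
      unfolding poly_det by (rule arg_cong[where f = det]) (simp add: vec_eq_iff P_def B_def)
    moreover have "poly (det Q) x = det C"
      unfolding poly_det
      by (rule arg_cong[where f = det]) (simp add: vec_eq_iff Q_def C_def P_def B_def)
    ultimately show ?thesis by simp
  qed
  then have "poly (smult (v $ k) (det P)) = poly ([:0, 1:] * det Q)"
    by (auto simp: fun_eq_iff)
  then have factor: "smult (v $ k) (det P) = [:0, 1:] * det Q"
    by (simp only: poly_eq_poly_eq_iff)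
  have nz: "poly (det Q) 0 \<noteq> 0"
  proof -
    define C where "C = (\<chi> i j. if j = k then v $ i else - complexify M $ i $ j)"
    have "u = 0" if "C *v u = 0" for u
    proof -
      define u' where "u' = (\<chi> j. if j = k then 0 else u $ j)"
      have "(C *v u) $ i = u $ k * v $ i - (complexify M *v u') $ i" for i
      proof -
        have "(C *v u) $ i = (\<Sum>j\<in>UNIV. (if j = k then u $ k * v $ i else 0) - complexify M $ i $ j * u' $ j)"
          unfolding matrix_vector_mult_def C_def u'_def by (simp, rule sum.cong) auto
        then show ?thesis by (simp add: sum_subtractf matrix_vector_mult_def)
      qed
      with that have "complexify M *v u' = u $ k *s v" by (simp add: vec_eq_iff)
      then obtain d where "u $ k = 0" and d: "u' = d *s v" using semisimple by blast
      have "u' $ k = 0" by (simp add: u'_def)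
      then have "d = 0" using d \<open>v $ k \<noteq> 0\<close> by simp
      then have "u' = 0" using d by simp
      then have "u' $ j = 0" for j by simp
      then have "u $ j = 0" for j
        using \<open>u $ k = 0\<close> unfolding u'_def vec_lambda_beta by metis
      then show "u = 0" by (simp add: vec_eq_iff)
    qed
    then have "invertible C"
      by (simp only: invertible_left_inverse matrix_left_invertible_ker) blast
    then have "det C \<noteq> 0" by (simp add: invertible_det_nz)
    moreover have "poly (det Q) 0 = det C"
      unfolding poly_det by (rule arg_cong[where f = det]) (simp add: vec_eq_iff Q_def C_def P_def)
    ultimately show ?thesis by simp
  qed
  then have "det Q \<noteq> 0" by auto
  have "order 0 (det P) = order 0 ([:0, 1:] * det Q)"
    using \<open>v $ k \<noteq> 0\<close> by (metis factor order_smult)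
  also have "\<dots> = order 0 [:0, 1::complex:] + order 0 (det Q)"
    using \<open>det Q \<noteq> 0\<close> by (intro order_mult) simp
  also have "\<dots> = 1"
    using nz order_power_n_n[of "0::complex" 1] by (simp add: order_0I)
  finally have "order 0 (det P) = 1" .
  then have "order 0 (characteristic_poly M) = 1"
    by (simp add: characteristic_poly_def P_def)
  moreover have "eigenvalue M 0" using \<open>v \<noteq> 0\<close> ker by (auto simp: eigenvalue_def)
  ultimately show ?thesis by (simp add: simple_eigenvalue_def)
qed

section \<open>The Jacobian of the coupled system\<close>

text \<open>
  A real matrix acts separately on real and imaginary parts, so the complexified Jacobian is known
  once the real differential is.
\<close>

lemma complexify_mult:
  "(complexify M *v u) $ i =
     Complex ((M *v (\<chi> j. Re (u $ j))) $ i) ((M *v (\<chi> j. Im (u $ j))) $ i)"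
  by (simp add: complex_eq_iff matrix_vector_mult_def complexify_def)

text \<open>
  The differential of the coupled field at \<open>z\<close> in real coordinates. The last term of each
  component comes from the derivative of \<open>\<bar>z\<^bsub>j\<^esub>\<bar>\<^sup>2\<close>, which is twice the inner product of \<open>z\<^bsub>j\<^esub>\<close> with
  the perturbation.
\<close>

definition field_differential :: "real \<Rightarrow> real \<Rightarrow> real^'n^'n \<Rightarrow> complex^'n \<Rightarrow> real^('n+'n) \<Rightarrow> real^('n+'n)" where
  "field_differential \<tau> \<beta> A z h = (\<chi> i. case i of
      Inl j \<Rightarrow> laplacian A (\<chi> l. h $ Inl l) $ j + 1 / \<tau> * ((1 - (cmod (z $ j))\<^sup>2 / \<beta>\<^sup>2) * h $ Inl j
                - 2 / \<beta>\<^sup>2 * (Re (z $ j) * h $ Inl j + Im (z $ j) * h $ Inr j) * Re (z $ j))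
    | Inr j \<Rightarrow> laplacian A (\<chi> l. h $ Inr l) $ j + 1 / \<tau> * ((1 - (cmod (z $ j))\<^sup>2 / \<beta>\<^sup>2) * h $ Inr j
                - 2 / \<beta>\<^sup>2 * (Re (z $ j) * h $ Inl j + Im (z $ j) * h $ Inr j) * Im (z $ j)))"

lemma has_derivative_vecI:
  fixes f :: "'a::real_normed_vector \<Rightarrow> real^'m"
  assumes "\<And>i. ((\<lambda>x. f x $ i) has_derivative (\<lambda>h. f' h $ i)) (at x)"
  shows "(f has_derivative f') (at x)"
  using assms by (subst has_derivative_componentwise_within) (auto simp: Basis_vec_def inner_axis)

lemma coupled_field_has_derivative:
  fixes z :: "complex^'n"
  shows "((real_coords \<circ> coupled_field \<tau> \<beta> A \<circ> complex_coords) has_derivative field_differential \<tau> \<beta> A z)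
     (at (real_coords z))"
proof (rule has_derivative_vecI)
  fix i :: "'n + 'n"
  note [derivative_intros] = bounded_linear.has_derivative[OF bounded_linear_vec_nth]
  have self_interaction: "((\<lambda>x. 1 / \<tau> * (1 - ((x $ Inl j)\<^sup>2 + (x $ Inr j)\<^sup>2) / \<beta>\<^sup>2) * x $ k)
      has_derivative (\<lambda>h. 1 / \<tau> * ((1 - (cmod (z $ j))\<^sup>2 / \<beta>\<^sup>2) * h $ k
        - 2 / \<beta>\<^sup>2 * (Re (z $ j) * h $ Inl j + Im (z $ j) * h $ Inr j) * real_coords z $ k)))
      (at (real_coords z))" for j and k :: "'n + 'n"
  proof -
    \<comment> \<open>Naming the constant factor keeps the quotient rule, with its condition \<open>\<beta> \<noteq> 0\<close>, out of the way.\<close>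
    define c where "c = 1 / \<beta>\<^sup>2"
    have "((\<lambda>x. 1 / \<tau> * (1 - ((x $ Inl j)\<^sup>2 + (x $ Inr j)\<^sup>2) * c) * x $ k)
        has_derivative (\<lambda>h. 1 / \<tau> * ((1 - (cmod (z $ j))\<^sup>2 * c) * h $ k
          - 2 * c * (Re (z $ j) * h $ Inl j + Im (z $ j) * h $ Inr j) * real_coords z $ k)))
        (at (real_coords z))"
      by (rule derivative_eq_intros refl)+
        (simp add: real_coords_def cmod_power2 fun_eq_iff algebra_simps)
    then show ?thesis by (simp add: c_def)
  qed
  have coupling: "((\<lambda>x. \<Sum>l\<in>UNIV. A $ j $ l * (x $ k l - x $ k j))
      has_derivative (\<lambda>h. laplacian A (\<chi> l. h $ k l) $ j)) (at (real_coords z))"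
    for j and k :: "'n \<Rightarrow> 'n + 'n"
    by (rule derivative_eq_intros refl)+ (simp add: laplacian_def)
  show "((\<lambda>x. (real_coords \<circ> coupled_field \<tau> \<beta> A \<circ> complex_coords) x $ i)
          has_derivative (\<lambda>h. field_differential \<tau> \<beta> A z h $ i)) (at (real_coords z))"
  proof (cases i)
    case (Inl j)
    show ?thesis
      using has_derivative_add[OF coupling[of j Inl] self_interaction[of j "Inl j"]]
      by (simp add: Inl o_def real_coords_def coupled_field_def complex_coords_def cmod_power2 field_differential_def)
  next
    case (Inr j)
    show ?thesis
      using has_derivative_add[OF coupling[of j Inr] self_interaction[of j "Inr j"]]
      by (simp add: Inr o_def real_coords_def coupled_field_def complex_coords_def cmod_power2 field_differential_def)
  qed
qed

lemma jacobian_coupled_field_mult: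
  "real_jacobian (coupled_field \<tau> \<beta> A) z *v h = field_differential \<tau> \<beta> A z h"
proof -
  let ?f = "real_coords \<circ> coupled_field \<tau> \<beta> A \<circ> complex_coords"
  have "(?f has_derivative (\<lambda>h. jacobian ?f (at (real_coords z)) *v h)) (at (real_coords z))"
    using coupled_field_has_derivative by (metis differentiableI jacobian_works)
  from has_derivative_unique[OF this coupled_field_has_derivative]
  show ?thesis by (simp add: real_jacobian_def fun_eq_iff)
qed

lemma complex_jacobian_mult:
  fixes z :: "complex^'n" and u :: "complex^('n + 'n)" and \<tau> \<beta> :: real and A :: "real^'n^'n"
  defines "Jac \<equiv> complexify (real_jacobian (coupled_field \<tau> \<beta> A) z)"
  shows "(Jac *v u) $ Inl j = laplacian A (\<chi> l. u $ Inl l) $ j + 1 / \<tau> * ((1 - (cmod (z $ j))\<^sup>2 / \<beta>\<^sup>2) * u $ Inl j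
                - 2 / \<beta>\<^sup>2 * (Re (z $ j) * u $ Inl j + Im (z $ j) * u $ Inr j) * Re (z $ j))"
    and "(Jac *v u) $ Inr j = laplacian A (\<chi> l. u $ Inr l) $ j + 1 / \<tau> * ((1 - (cmod (z $ j))\<^sup>2 / \<beta>\<^sup>2) * u $ Inr j
                - 2 / \<beta>\<^sup>2 * (Re (z $ j) * u $ Inl j + Im (z $ j) * u $ Inr j) * Im (z $ j))"
  unfolding Jac_def complexify_mult jacobian_coupled_field_mult field_differential_def
  by (simp_all add: complex_eq_iff Re_laplacian Im_laplacian
      flip: of_real_power of_real_diff of_real_divide of_real_mult)

section \<open>Radial and tangential perturbations of a synchronized state\<close>

text \<open>
  For a real perturbation with components \<open>h\<^bsub>j\<^esub>\<close>, these are the inner products of \<open>h\<^bsub>j\<^esub>\<close> with \<open>w\<close> and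
  with \<open>i w\<close>. They are extended complex linearly to the complexified space, where real and imaginary
  coordinates of a perturbation are themselves complex.
\<close>

definition radial :: "complex \<Rightarrow> complex^('n + 'n) \<Rightarrow> complex^'n" where
  "radial w u = (\<chi> j. Re w * u $ Inl j + Im w * u $ Inr j)"

definition tangential :: "complex \<Rightarrow> complex^('n + 'n) \<Rightarrow> complex^'n" where
  "tangential w u = (\<chi> j. - Im w * u $ Inl j + Re w * u $ Inr j)"

lemma radial_smult: "radial w (c *s u) $ j = c * radial w u $ j"
  and tangential_smult: "tangential w (c *s u) $ j = c * tangential w u $ j"
  by (simp_all add: radial_def tangential_def algebra_simps)

text \<open>
  The change of coordinates is \<open>\<bar>w\<bar>\<close> times a rotation in every component, hence injective; its
  inverse is given by the two identities for the \<open>Inl\<close> and \<open>Inr\<close> coordinates.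
\<close>

lemma radial_tangential_ext:
  fixes u v :: "complex^('n::finite + 'n)"
  assumes "w \<noteq> 0"
    and r: "\<And>j. radial w u $ j = radial w v $ j" and t: "\<And>j. tangential w u $ j = tangential w v $ j"
  shows "u = v"
proof -
  have "(Re w)\<^sup>2 + (Im w)\<^sup>2 \<noteq> 0"
    using \<open>w \<noteq> 0\<close> by (simp add: complex_eq_iff sum_power2_eq_zero_iff)
  then have nz: "complex_of_real (Re w) ^ 2 + complex_of_real (Im w) ^ 2 \<noteq> 0"
    by (metis of_real_add of_real_eq_0_iff of_real_power)
  define \<rho> where "\<rho> = complex_of_real (Re w) ^ 2 + complex_of_real (Im w) ^ 2"
  have inl: "\<rho> * x $ Inl j = Re w * radial w x $ j - Im w * tangential w x $ j"
    and inr: "\<rho> * x $ Inr j = Im w * radial w x $ j + Re w * tangential w x $ j"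
    for x :: "complex^('n + 'n)" and j
    by (simp_all add: \<rho>_def radial_def tangential_def power2_eq_square algebra_simps)
  have "\<rho> * u $ i = \<rho> * v $ i" for i
    by (cases i) (simp_all only: inl inr r t)
  then have "u $ i = v $ i" for i
    using nz by (simp add: \<rho>_def)
  then show ?thesis by (simp add: vec_eq_iff)
qed

text \<open>
  Since \<open>\<bar>w\<bar> = \<beta>\<close>, the factor \<open>1 - \<bar>z\<^bsub>j\<^esub>\<bar>\<^sup>2 / \<beta>\<^sup>2\<close> vanishes and the reaction term only contributes a
  multiple of \<open>w\<close>, which is orthogonal to \<open>i w\<close>. The Laplacian has real coefficients and acts on
  every component alike, so it commutes with the projections.
\<close>

lemma jacobian_synchronized:
  fixes z :: "complex^'n" and u :: "complex^('n + 'n)" and \<tau> \<beta> :: real and A :: "real^'n^'n"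
  defines "Jac \<equiv> complexify (real_jacobian (coupled_field \<tau> \<beta> A) z)"
  assumes "\<beta> > 0" and z: "\<And>j. z $ j = w" and w: "cmod w = \<beta>"
  shows "radial w (Jac *v u) $ j = laplacian A (radial w u) $ j - of_real (2 / \<tau>) * radial w u $ j"
    and "tangential w (Jac *v u) $ j = laplacian A (tangential w u) $ j"
proof -
  define a b where "a = complex_of_real (Re w)" and "b = complex_of_real (Im w)"
  have "a\<^sup>2 + b\<^sup>2 = of_real (\<beta>\<^sup>2)"
    by (simp add: a_def b_def cmod_power2 flip: w of_real_power of_real_add)
  then have ab: "2 / complex_of_real \<tau> / of_real (\<beta>\<^sup>2) * (a\<^sup>2 + b\<^sup>2) = 2 / of_real \<tau>"
    using \<open>\<beta> > 0\<close> by simp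
  \<comment> \<open>The damping rate, normalised so that \<open>\<kappa> (a\<^sup>2 + b\<^sup>2) = 2/\<tau>\<close>.\<close>
  define \<kappa> where "\<kappa> = 2 / complex_of_real \<tau> / of_real (\<beta>\<^sup>2)"
  have Inl: "(Jac *v u) $ Inl l = laplacian A (\<chi> l. u $ Inl l) $ l
      - \<kappa> * (a * u $ Inl l + b * u $ Inr l) * a" for l
    using \<open>\<beta> > 0\<close> w unfolding Jac_def complex_jacobian_mult z a_def b_def \<kappa>_def by simp
  have Inr: "(Jac *v u) $ Inr l = laplacian A (\<chi> l. u $ Inr l) $ l
      - \<kappa> * (a * u $ Inl l + b * u $ Inr l) * b" for l
    using \<open>\<beta> > 0\<close> w unfolding Jac_def complex_jacobian_mult z a_def b_def \<kappa>_def by simp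
  have lap_r: "laplacian A (radial w u) $ j
      = a * laplacian A (\<chi> l. u $ Inl l) $ j + b * laplacian A (\<chi> l. u $ Inr l) $ j"
    using laplacian_lincomb[of A "Re w" "\<chi> l. u $ Inl l" "Im w" "\<chi> l. u $ Inr l" j]
    by (simp add: radial_def a_def b_def)
  have lap_t: "laplacian A (tangential w u) $ j
      = - b * laplacian A (\<chi> l. u $ Inl l) $ j + a * laplacian A (\<chi> l. u $ Inr l) $ j"
    using laplacian_lincomb[of A "- Im w" "\<chi> l. u $ Inl l" "Re w" "\<chi> l. u $ Inr l" j]
    by (simp add: tangential_def a_def b_def)
  have "radial w (Jac *v u) $ j
      = laplacian A (radial w u) $ j - \<kappa> * (a\<^sup>2 + b\<^sup>2) * (a * u $ Inl j + b * u $ Inr j)"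
    by (simp add: radial_def[of w "Jac *v u"] Inl Inr lap_r power2_eq_square algebra_simps
        flip: a_def b_def)
  then show "radial w (Jac *v u) $ j
      = laplacian A (radial w u) $ j - of_real (2 / \<tau>) * radial w u $ j"
    using ab by (simp only: \<kappa>_def radial_def[of w u] vec_lambda_beta of_real_divide of_real_numeral flip: a_def b_def)
  show "tangential w (Jac *v u) $ j = laplacian A (tangential w u) $ j"
    by (simp add: tangential_def[of w "Jac *v u"] Inl Inr lap_t algebra_simps flip: a_def b_def)
qed

section \<open>Stability of the origin and of the synchronized states\<close>

text \<open>
  All nodes moving in unison do not feel the coupling, and at the origin the reaction term expands
  at rate \<open>1/\<tau>\<close>.
\<close>

lemma origin_unstable:
  fixes \<tau> \<beta> :: real and A :: "real^'n^'n"
  assumes "\<tau> > 0"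
  shows "linearly_unstable (coupled_field \<tau> \<beta> A) 0"
proof -
  define u :: "complex^('n + 'n)" where "u = (\<chi> i. case i of Inl j \<Rightarrow> 1 | Inr j \<Rightarrow> 0)"
  have u: "(\<chi> l. u $ Inl l) = (\<chi> l::'n. 1)" "(\<chi> l. u $ Inr l) = (\<chi> l::'n. 0)"
    by (simp_all add: u_def)
  have "(complexify (real_jacobian (coupled_field \<tau> \<beta> A) 0) *v u) $ i = of_real (1 / \<tau>) * u $ i" for i
    by (cases i) (simp_all add: complex_jacobian_mult u)
  then have "complexify (real_jacobian (coupled_field \<tau> \<beta> A) 0) *v u = of_real (1 / \<tau>) *s u"
    by (simp add: vec_eq_iff)
  moreover have "u \<noteq> 0"
    by (simp add: u_def vec_eq_iff) (metis sum.case(1) zero_neq_one)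
  ultimately have "eigenvalue (real_jacobian (coupled_field \<tau> \<beta> A) 0) (of_real (1 / \<tau>))"
    by (auto simp: eigenvalue_def)
  moreover have "fixed_point (coupled_field \<tau> \<beta> A) 0"
    by (simp add: fixed_point_def coupled_field_def vec_eq_iff)
  ultimately show ?thesis using \<open>\<tau> > 0\<close>
    unfolding linearly_unstable_def by (metis Re_complex_of_real zero_less_divide_1_iff)
qed

lemma synchronized_class_stable:
  fixes \<tau> \<beta> :: real and A :: "real^'n^'n"
  assumes "\<tau> > 0" and "\<beta> > 0"
    and nonneg: "\<And>i j. A $ i $ j \<ge> 0"
    and tree: "has_directed_spanning_tree (transpose A)"
  shows "linearly_stable_class (coupled_field \<tau> \<beta> A) (synchronized_class \<beta>)"
  unfolding linearly_stable_class_def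
proof (intro ballI conjI allI impI)
  fix z :: "complex^'n" assume "z \<in> synchronized_class \<beta>"
  then obtain w where z: "\<And>j. z $ j = w" and w: "cmod w = \<beta>"
    by (simp add: synchronized_class_def) metis
  have "w \<noteq> 0" using w \<open>\<beta> > 0\<close> by auto
  show "fixed_point (coupled_field \<tau> \<beta> A) z"
    using z w \<open>\<beta> > 0\<close> by (simp add: fixed_point_def coupled_field_def vec_eq_iff)
  let ?J = "real_jacobian (coupled_field \<tau> \<beta> A) z"
  note split = jacobian_synchronized[OF \<open>\<beta> > 0\<close> z w, of \<tau> A]
  have radial_zero: "radial w u = 0"
    if "\<And>j. radial w (complexify ?J *v u) $ j = c * radial w u $ j" "Re c \<ge> 0" for u c
  proof (rule ccontr)
    assume nz: "radial w u \<noteq> 0"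
    define c' where "c' = c + complex_of_real (2 / \<tau>)"
    have "laplacian A (radial w u) $ j = c' * radial w u $ j" for j
      using that(1)[of j] unfolding split(1) c'_def distrib_right by (simp only: diff_eq_eq)
    from laplacian_eigenvalue[OF nonneg this nz] have "c' = 0 \<or> Re c' < 0" .
    moreover have "Re c' > 0" using that(2) \<open>\<tau> > 0\<close> by (simp add: c'_def add_nonneg_pos)
    ultimately show False by auto
  qed
  show "Re c < 0" if c: "eigenvalue ?J c \<and> c \<noteq> 0" for c
  proof (rule ccontr)
    assume "\<not> Re c < 0"
    obtain u where "u \<noteq> 0" and u: "complexify ?J *v u = c *s u"
      using c unfolding eigenvalue_def by blast
    have "radial w u = 0"
      using \<open>\<not> Re c < 0\<close> by (intro radial_zero[of u c]) (simp_all add: u radial_smult)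
    moreover have "tangential w u = 0"
    proof (rule ccontr)
      assume "tangential w u \<noteq> 0"
      moreover have "laplacian A (tangential w u) $ j = c * tangential w u $ j" for j
        using split(2)[of u j] by (simp add: u tangential_smult)
      ultimately show False
        using laplacian_eigenvalue[OF nonneg] c \<open>\<not> Re c < 0\<close> by blast
    qed
    ultimately have "u = 0"
      by (intro radial_tangential_ext[OF \<open>w \<noteq> 0\<close>]) (simp_all add: radial_def[of w 0] tangential_def[of w 0])
    with \<open>u \<noteq> 0\<close> show False ..
  qed
  \<comment> \<open>The perturbation \<open>i w\<close> in every component, the infinitesimal global rotation.\<close>
  define v :: "complex^('n + 'n)" where
    "v = (\<chi> i. case i of Inl j \<Rightarrow> of_real (- Im w) | Inr j \<Rightarrow> of_real (Re w))"
  have v_radial: "radial w v $ j = 0" for j by (simp add: v_def radial_def)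
  have v_tangential: "tangential w v $ j = of_real (\<beta>\<^sup>2)" for j
    unfolding w[symmetric] cmod_power2 by (simp add: v_def tangential_def power2_eq_square)
  have v_parts: "radial w v = 0" "tangential w v = (\<chi> j. of_real (\<beta>\<^sup>2))"
    by (simp_all add: vec_eq_iff v_radial v_tangential)
  show "simple_eigenvalue ?J 0"
  proof (rule simple_zero_eigenvalue[of v])
    show "v \<noteq> 0"
      using v_tangential \<open>\<beta> > 0\<close> by (auto simp: tangential_def)
    show "complexify ?J *v v = 0"
      by (rule radial_tangential_ext[OF \<open>w \<noteq> 0\<close>])
        (simp_all only: split v_parts, simp_all add: radial_def tangential_def laplacian_def)
    fix u c assume u: "complexify ?J *v u = c *s v"
    have rad: "radial w u = 0"
      by (rule radial_zero[of u 0]) (simp_all add: u radial_smult v_radial)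
    have "laplacian A (tangential w u) $ j = c * of_real (\<beta>\<^sup>2)" for j
      using split(2)[of u j] by (simp add: u tangential_smult v_tangential)
    then obtain r where "c * of_real (\<beta>\<^sup>2) = 0" and r: "\<And>j. tangential w u $ j = r"
      using complex_laplacian_eq_const[OF nonneg tree] by metis
    then have "c = 0" using \<open>\<beta> > 0\<close> by simp
    moreover have "u = (r / of_real (\<beta>\<^sup>2)) *s v"
      using \<open>\<beta> > 0\<close>
      by (intro radial_tangential_ext[OF \<open>w \<noteq> 0\<close>])
        (simp_all add: radial_smult tangential_smult rad v_parts r)
    ultimately show "c = 0 \<and> (\<exists>d. u = d *s v)" by blast
  qed
qed

theorem theorem5:
  fixes \<tau> \<beta> :: real and A :: "real^'n^'n"
  assumes "\<tau> > 0" and "\<beta> > 0"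
    and "\<And>i j. A $ i $ j \<ge> 0"
    and "has_directed_spanning_tree (transpose A)"
  shows "linearly_unstable (coupled_field \<tau> \<beta> A) 0 \<and>
         linearly_stable_class (coupled_field \<tau> \<beta> A) (synchronized_class \<beta>)"
  using origin_unstable synchronized_class_stable assms by blast

end
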